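(* Let $G$ be a unipotent algebraic group with $\dim G>0$. Then there is no rational linear étale representation of $G$.
   Context: All groups are linear algebraic groups over $\mathbb{C}$. A rational linear étale representation of $G$ is a rational representation $\varrho:G\to\mathrm{GL}(V)$ on a finite-dimensional complex vector space $V$ such that $G$ has a Zariski-open orbit in $V$ and $\dim G=\dim V$. *)

theory Defs
  imports
    "HOL-Analysis.Analysis"
    "HOL-Algebra.Group"
    "HOL-Library.Extended_Nat"
begin

text \<open>Polynomial expressions in a given set \<open>X\<close> of coordinate functions, i.e. the
  \<open>\<complex>\<close>-algebra of functions generated by \<open>X\<close>.\<close>

inductive_set generated_algebra :: "('a \<Rightarrow> complex) set \<Rightarrow> ('a \<Rightarrow> complex) set"
  for X :: "('a \<Rightarrow> complex) set"
where
  gen: "f \<in> X \<Longrightarrow> f \<in> generated_algebra X"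
| const: "(\<lambda>_. c) \<in> generated_algebra X"
| add: "f \<in> generated_algebra X \<Longrightarrow> g \<in> generated_algebra X \<Longrightarrow>
    (\<lambda>x. f x + g x) \<in> generated_algebra X"
| mult: "f \<in> generated_algebra X \<Longrightarrow> g \<in> generated_algebra X \<Longrightarrow>
    (\<lambda>x. f x * g x) \<in> generated_algebra X"

definition zariski_topology :: "('a \<Rightarrow> complex) set \<Rightarrow> 'a topology" where
  "zariski_topology X =
     topology (\<lambda>U. \<exists>S \<subseteq> generated_algebra X. U = - {x. \<forall>f\<in>S. f x = 0})"

lemma istopology_zariski:
  "istopology (\<lambda>U. \<exists>S \<subseteq> generated_algebra X. U = - {x. \<forall>f\<in>S. f x = 0})"
  unfolding istopology_def
proof (intro conjI allI impI)
  fix U V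
  assume "\<exists>S \<subseteq> generated_algebra X. U = - {x. \<forall>f\<in>S. f x = 0}"
    and "\<exists>S \<subseteq> generated_algebra X. V = - {x. \<forall>f\<in>S. f x = 0}"
  then obtain S T where S: "S \<subseteq> generated_algebra X" "U = - {x. \<forall>f\<in>S. f x = 0}"
    and T: "T \<subseteq> generated_algebra X" "V = - {x. \<forall>f\<in>T. f x = 0}"
    by blast
  let ?P = "(\<lambda>(f, g) x. f x * g x) ` (S \<times> T)"
  have "?P \<subseteq> generated_algebra X"
    using S(1) T(1) by (auto intro: generated_algebra.mult)
  moreover have "U \<inter> V = - {x. \<forall>f\<in>?P. f x = 0}"
    unfolding S(2) T(2) by auto
  ultimately show "\<exists>S \<subseteq> generated_algebra X. U \<inter> V = - {x. \<forall>f\<in>S. f x = 0}"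
    by blast
next
  fix K
  assume "\<forall>U\<in>K. \<exists>S \<subseteq> generated_algebra X. U = - {x. \<forall>f\<in>S. f x = 0}"
  then obtain S where S: "\<forall>U\<in>K. S U \<subseteq> generated_algebra X \<and> U = - {x. \<forall>f\<in>S U. f x = 0}"
    by (rule bchoice[THEN exE])
  have mem: "x \<in> U \<longleftrightarrow> (\<exists>f\<in>S U. f x \<noteq> 0)" if "U \<in> K" for x U
  proof -
    have "U = - {x. \<forall>f\<in>S U. f x = 0}"
      using S that by blast
    then have "x \<in> U \<longleftrightarrow> x \<in> - {x. \<forall>f\<in>S U. f x = 0}"
      by (rule arg_cong)
    then show ?thesis
      by simp
  qed
  have "(\<Union>U\<in>K. S U) \<subseteq> generated_algebra X"
    using S by (intro UN_least) simp
  moreover have "\<Union>K = - {x. \<forall>f\<in>(\<Union>U\<in>K. S U). f x = 0}"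
    by (rule Set.set_eqI) (simp add: mem)
  ultimately show "\<exists>S \<subseteq> generated_algebra X. \<Union>K = - {x. \<forall>f\<in>S. f x = 0}"
    by (intro exI conjI)
qed

lemma openin_zariski:
  "openin (zariski_topology X) U \<longleftrightarrow>
     (\<exists>S \<subseteq> generated_algebra X. U = - {x. \<forall>f\<in>S. f x = 0})"
  by (simp add: zariski_topology_def topology_inverse'[OF istopology_zariski])

lemma topspace_zariski [simp]: "topspace (zariski_topology X) = UNIV"
proof -
  have "openin (zariski_topology X) UNIV"
    unfolding openin_zariski
    by (rule exI[of _ "{\<lambda>_. 1}"]) (auto intro: generated_algebra.const)
  then show ?thesis
    using openin_subset by blast
qed

lemma closedin_zariski:
  "closedin (zariski_topology X) Z \<longleftrightarrow>
     (\<exists>S \<subseteq> generated_algebra X. Z = {x. \<forall>f\<in>S. f x = 0})"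
  unfolding closedin_def topspace_zariski openin_zariski Compl_eq_Diff_UNIV[symmetric]
  by (simp only: subset_UNIV simp_thms Compl_eq_Compl_iff)

definition irreducible_in :: "'a topology \<Rightarrow> 'a set \<Rightarrow> bool" where
  "irreducible_in T Z \<longleftrightarrow>
     Z \<subseteq> topspace T \<and> Z \<noteq> {} \<and>
     (\<forall>A B. closedin T A \<and> closedin T B \<and> Z \<subseteq> A \<union> B \<longrightarrow> Z \<subseteq> A \<or> Z \<subseteq> B)"

text \<open>On a linear algebraic group with its Zariski topology, the Krull dimension is the
  dimension of the group as a variety. The empty space gets dimension 0 here.\<close>

definition krull_dim :: "'a topology \<Rightarrow> enat" where
  "krull_dim T = Sup {enat n | n. \<exists>Z :: nat \<Rightarrow> 'a set.
     (\<forall>i\<le>n. closedin T (Z i) \<and> irreducible_in T (Z i)) \<and> (\<forall>i<n. Z i \<subset> Z (Suc i))}"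

definition GL_mat :: "(complex ^ 'n ^ 'n) monoid" where
  "GL_mat = \<lparr>carrier = {A. invertible A}, mult = (**), one = mat 1\<rparr>"

definition matrix_entries :: "(complex ^ 'n ^ 'n \<Rightarrow> complex) set" where
  "matrix_entries = {\<lambda>A. A $ i $ j | i j. True}"

definition linear_algebraic_group :: "(complex ^ 'n ^ 'n) set \<Rightarrow> bool" where
  "linear_algebraic_group G \<longleftrightarrow>
     subgroup G GL_mat \<and>
     closedin (subtopology (zariski_topology matrix_entries) (carrier GL_mat)) G"

definition group_dim :: "(complex ^ 'n ^ 'n) set \<Rightarrow> enat" where
  "group_dim G = krull_dim (subtopology (zariski_topology matrix_entries) G)"

text \<open>Powers are iterated matrix products: the power operation \<open>^\<close> on \<open>complex ^ 'n ^ 'n\<close> is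
  componentwise.\<close>

definition unipotent_matrix :: "complex ^ 'n ^ 'n \<Rightarrow> bool" where
  "unipotent_matrix A \<longleftrightarrow> (\<exists>k. (((**) (A - mat 1)) ^^ k) (mat 1) = 0)"

definition unipotent_group :: "(complex ^ 'n ^ 'n) set \<Rightarrow> bool" where
  "unipotent_group G \<longleftrightarrow> linear_algebraic_group G \<and> (\<forall>A\<in>G. unipotent_matrix A)"

text \<open>The coordinate ring of \<open>GL\<^sub>n\<close> is generated by the matrix entries and \<open>1/det\<close>; regular
  functions on a closed subgroup are the restrictions of its elements.\<close>

definition regular_on :: "(complex ^ 'n ^ 'n) set \<Rightarrow> (complex ^ 'n ^ 'n \<Rightarrow> complex) \<Rightarrow> bool" where
  "regular_on G f \<longleftrightarrow>
     (\<exists>p \<in> generated_algebra (matrix_entries \<union> {\<lambda>A. inverse (det A)}). \<forall>A\<in>G. f A = p A)"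

definition linear_functionals :: "(complex \<Rightarrow> 'v \<Rightarrow> 'v) \<Rightarrow> ('v::ab_group_add \<Rightarrow> complex) set" where
  "linear_functionals scl = {l. Vector_Spaces.linear scl (*) l}"

definition GL_space :: "(complex \<Rightarrow> 'v \<Rightarrow> 'v) \<Rightarrow> ('v::ab_group_add \<Rightarrow> 'v) monoid" where
  "GL_space scl =
     \<lparr>carrier = {T. Vector_Spaces.linear scl scl T \<and> bij T}, mult = (\<circ>), one = id\<rparr>"

text \<open>Rationality says that all matrix coefficients are regular functions on \<open>G\<close>, i.e. that
  in any basis the matrix of \<open>\<rho> A\<close> depends regularly on \<open>A\<close>.\<close>

definition rational_representation ::
  "(complex ^ 'n ^ 'n) set \<Rightarrow> (complex \<Rightarrow> 'v \<Rightarrow> 'v) \<Rightarrow>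
   (complex ^ 'n ^ 'n \<Rightarrow> 'v::ab_group_add \<Rightarrow> 'v) \<Rightarrow> bool" where
  "rational_representation G scl \<rho> \<longleftrightarrow>
     \<rho> \<in> hom (GL_mat\<lparr>carrier := G\<rparr>) (GL_space scl) \<and>
     (\<forall>l \<in> linear_functionals scl. \<forall>v. regular_on G (\<lambda>A. l (\<rho> A v)))"

definition etale_representation ::
  "(complex ^ 'n ^ 'n) set \<Rightarrow> (complex \<Rightarrow> 'v \<Rightarrow> 'v) \<Rightarrow>
   (complex ^ 'n ^ 'n \<Rightarrow> 'v::ab_group_add \<Rightarrow> 'v) \<Rightarrow> bool" where
  "etale_representation G scl \<rho> \<longleftrightarrow>
     rational_representation G scl \<rho> \<and>
     (\<exists>v. openin (zariski_topology (linear_functionals scl)) ((\<lambda>A. \<rho> A v) ` G)) \<and>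
     group_dim G = enat (vector_space.dim scl (UNIV :: 'v set))"

end

theory Submission
  imports Defs "HOL-Computational_Algebra.Polynomial"
begin

text \<open>
  Suppose that \<open>\<rho>\<close> is etale with open orbit \<open>\<rho>(G) v\<close>. Restricted to a line through \<open>v\<close>, the orbit
  is a nonempty Zariski-open subset of it, so it omits only finitely many points
  (\<open>zariski_open_meets_line\<close>). If \<open>v \<noteq> 0\<close>, the line \<open>\<complex>v\<close> itself therefore contains an orbit point
  \<open>c v\<close> with \<open>c \<noteq> 1\<close>; that is, some \<open>A \<in> G\<close> satisfies \<open>\<rho>(A) v = c v\<close>. If \<open>v = 0\<close>, the
  orbit is the single point \<open>0\<close>, which is not open because \<open>dim V = dim G > 0\<close>.

  An eigenvalue \<open>c \<noteq> 1\<close> is impossible, because \<open>A\<close> is unipotent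
  (\<open>unipotent_eigenvalue_eq_1\<close>). The entries of \<open>A\<^sup>k\<close> are polynomials in \<open>k\<close>, and so is every
  regular function of \<open>A\<^sup>k\<close>, once \<open>det A = 1\<close> is known. For a linear functional \<open>l\<close> with
  \<open>l v \<noteq> 0\<close> this makes \<open>c\<^sup>k l v = l (\<rho>(A\<^sup>k) v)\<close> a polynomial in \<open>k\<close>. But a nonzero polynomial \<open>q\<close> with
  \<open>q(k + 1) = c q(k)\<close> has \<open>c = 1\<close>, as one sees from its leading coefficient
  (\<open>geometric_polynomial_ratio_eq_1\<close>). The same observation, applied to \<open>det (A\<^sup>k) = (det A)\<^sup>k\<close>,
  gives \<open>det A = 1\<close>.
\<close>

section \<open>Polynomial dependence on a parameter\<close>

text \<open>The parameter \<open>h\<close> is the inclusion of the parameter set into \<open>\<complex>\<close>; this covers both lines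
  in a vector space (parameter in \<open>\<complex>\<close>) and the powers of a matrix (parameter in \<open>\<nat>\<close>).\<close>

definition polynomial_in :: "('t \<Rightarrow> complex) \<Rightarrow> ('t \<Rightarrow> complex) \<Rightarrow> bool" where
  "polynomial_in h s \<longleftrightarrow> (\<exists>q. \<forall>t. s t = poly q (h t))"

lemma polynomial_in_const: "polynomial_in h (\<lambda>_. c)"
  unfolding polynomial_in_def by (rule exI[of _ "[:c:]"]) simp

lemma polynomial_in_self: "polynomial_in h h"
  unfolding polynomial_in_def by (rule exI[of _ "[:0, 1:]"]) simp

lemma polynomial_in_add:
  assumes "polynomial_in h s" "polynomial_in h s'"
  shows "polynomial_in h (\<lambda>t. s t + s' t)"
  using assms unfolding polynomial_in_def by (metis poly_add)

lemma polynomial_in_mult: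
  assumes "polynomial_in h s" "polynomial_in h s'"
  shows "polynomial_in h (\<lambda>t. s t * s' t)"
  using assms unfolding polynomial_in_def by (metis poly_mult)

lemma polynomial_in_sum:
  assumes "\<And>i. i \<in> I \<Longrightarrow> polynomial_in h (s i)"
  shows "polynomial_in h (\<lambda>t. \<Sum>i\<in>I. s i t)"
  using assms
  by (induction I rule: infinite_finite_induct)
    (auto intro: polynomial_in_const polynomial_in_add)

lemma polynomial_in_binomial:
  "polynomial_in of_nat (\<lambda>k. of_nat (k choose i))"
proof (induction i)
  case 0
  show ?case by (simp add: polynomial_in_const)
next
  case (Suc i)
  have step: "of_nat (k choose Suc i) =
      (of_nat (k choose i) * (of_nat k + - of_nat i)) * (1 / of_nat (Suc i) :: complex)" for k
  proof -
    have "of_nat k * of_nat (k choose i) =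
        of_nat i * of_nat (k choose i) + of_nat (Suc i) * (of_nat (k choose Suc i) :: complex)"
      using gbinomial_mult_1[of "of_nat k :: complex" i] by (simp add: binomial_gbinomial)
    then have "of_nat (k choose Suc i) * of_nat (Suc i) =
        of_nat (k choose i) * (of_nat k + - of_nat i :: complex)"
      by algebra
    then show ?thesis
      using of_nat_neq_0[of i, where 'a = complex] by (simp only: nonzero_eq_divide_eq
          times_divide_eq_right mult_1_right simp_thms)
  qed
  show ?case
    unfolding step
    by (intro polynomial_in_mult polynomial_in_add Suc polynomial_in_self polynomial_in_const)
qed

lemma polynomial_in_generated_algebra:
  assumes "f \<in> generated_algebra X"
    and "\<And>x. x \<in> X \<Longrightarrow> polynomial_in h (\<lambda>t. x (\<gamma> t))"
  shows "polynomial_in h (\<lambda>t. f (\<gamma> t))"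
  using assms(1)
  by induction (auto intro: assms(2) polynomial_in_const polynomial_in_add polynomial_in_mult)

text \<open>The ratio is read off from leading coefficients, since \<open>q(x + 1)\<close> and \<open>q(x)\<close> have the same
  one; the recurrence holds as an identity of polynomials because it holds at infinitely many
  points.\<close>

lemma geometric_polynomial_ratio_eq_1:
  assumes poly: "polynomial_in of_nat s"
    and rec: "\<And>k::nat. s (Suc k) = c * s k"
    and nonzero: "s j \<noteq> 0"
  shows "c = 1"
proof -
  obtain q where q: "s k = poly q (of_nat k)" for k
    using poly unfolding polynomial_in_def by blast
  have "q \<noteq> 0"
    using nonzero q by auto
  have "pcompose q [:1, 1:] - smult c q = 0"
  proof (rule ccontr)
    assume "pcompose q [:1, 1:] - smult c q \<noteq> 0"
    then have "finite {x. poly (pcompose q [:1, 1:] - smult c q) x = 0}"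
      by (rule poly_roots_finite)
    moreover have "range (of_nat :: nat \<Rightarrow> complex) \<subseteq>
        {x. poly (pcompose q [:1, 1:] - smult c q) x = 0}"
      using rec q by (auto simp: poly_pcompose simp flip: of_nat_Suc)
    ultimately have "finite (range (of_nat :: nat \<Rightarrow> complex))"
      by (rule rev_finite_subset)
    then show False
      using inj_of_nat finite_imageD infinite_UNIV_nat by blast
  qed
  then have "lead_coeff (pcompose q [:1, 1:]) = lead_coeff (smult c q)"
    by simp
  moreover have "lead_coeff (pcompose q [:1, 1:]) = lead_coeff q"
    by (subst lead_coeff_comp) simp_all
  moreover have "lead_coeff (smult c q) = c * lead_coeff q"
    by (rule lead_coeff_smult)
  ultimately have "lead_coeff q = c * lead_coeff q"
    by (simp only:)
  then show ?thesis
    using \<open>q \<noteq> 0\<close> mult_cancel_right1[of "lead_coeff q" c] by (simp only: leading_coeff_0_iff simp_thms)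
qed

text \<open>Newton's forward difference formula: \<open>f j\<close> is the \<open>j\<close>-th difference sequence of \<open>f 0\<close>.\<close>

lemma newton_forward_differences:
  fixes f :: "nat \<Rightarrow> nat \<Rightarrow> complex"
  assumes "\<And>j k. f j (Suc k) = f j k + f (Suc j) k"
  shows "f j k = (\<Sum>i\<le>k. of_nat (k choose i) * f (j + i) 0)"
proof (induction k arbitrary: j)
  case (Suc k)
  have "(\<Sum>i\<le>Suc k. of_nat (Suc k choose i) * f (j + i) 0)
      = f j 0 + (\<Sum>i\<le>k. of_nat (Suc k choose Suc i) * f (j + Suc i) 0)"
    by (simp add: sum.atMost_Suc_shift del: sum.atMost_Suc binomial_Suc_Suc)
  also have "\<dots> = (f j 0 + (\<Sum>i\<le>k. of_nat (k choose Suc i) * f (j + Suc i) 0))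
      + (\<Sum>i\<le>k. of_nat (k choose i) * f (Suc j + i) 0)"
    by (simp add: algebra_simps sum.distrib)
  also have "f j 0 + (\<Sum>i\<le>k. of_nat (k choose Suc i) * f (j + Suc i) 0)
      = (\<Sum>i\<le>Suc k. of_nat (k choose i) * f (j + i) 0)"
    by (simp add: sum.atMost_Suc_shift del: sum.atMost_Suc)
  also have "\<dots> = (\<Sum>i\<le>k. of_nat (k choose i) * f (j + i) 0)"
    by simp
  finally show ?case
    using assms Suc by simp
qed simp

lemma polynomial_in_if_differences_vanish:
  fixes f :: "nat \<Rightarrow> nat \<Rightarrow> complex"
  assumes "\<And>j k. f j (Suc k) = f j k + f (Suc j) k"
    and vanish: "\<And>j. j \<ge> m \<Longrightarrow> f j 0 = 0"
  shows "polynomial_in of_nat (f 0)"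
proof -
  have "f 0 k = (\<Sum>i<m. of_nat (k choose i) * f i 0)" for k
  proof -
    have "f 0 k = (\<Sum>i\<le>k. of_nat (k choose i) * f i 0)"
      using newton_forward_differences[of f 0 k] assms(1) by simp
    also have "\<dots> = (\<Sum>i\<in>{..k} \<inter> {..<m}. of_nat (k choose i) * f i 0)"
      by (rule sum.mono_neutral_right) (use vanish in \<open>auto simp: not_less\<close>)
    also have "\<dots> = (\<Sum>i<m. of_nat (k choose i) * f i 0)"
      by (rule sum.mono_neutral_left) (auto simp: binomial_eq_0)
    finally show ?thesis .
  qed
  then have eq: "f 0 = (\<lambda>k. \<Sum>i<m. of_nat (k choose i) * f i 0)"
    by auto
  show ?thesis
    unfolding eq
    by (intro polynomial_in_sum polynomial_in_mult polynomial_in_binomial polynomial_in_const)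
qed

section \<open>Powers of a unipotent matrix\<close>

text \<open>Multiplying on the right makes \<open>\<rho>(A\<^sup>k\<^sup>+\<^sup>1) v = \<rho>(A\<^sup>k) (\<rho>(A) v)\<close> immediate, which is the form
  needed for an eigenvector \<open>v\<close> of \<open>\<rho>(A)\<close>.\<close>

definition matrix_power :: "complex ^ 'n ^ 'n \<Rightarrow> nat \<Rightarrow> complex ^ 'n ^ 'n" where
  "matrix_power A k = ((\<lambda>M. M ** A) ^^ k) (mat 1)"

lemma matrix_power_0 [simp]: "matrix_power A 0 = mat 1"
  and matrix_power_Suc [simp]: "matrix_power A (Suc k) = matrix_power A k ** A"
  by (simp_all add: matrix_power_def)

lemma matrix_add_rdistrib:
  fixes B C :: "'a::semiring_1 ^ 'n ^ 'm"
  shows "(B + C) ** A = B ** A + C ** A"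
  by (simp add: matrix_matrix_mult_def vec_eq_iff sum.distrib distrib_right)

text \<open>With \<open>N = A - 1\<close>, the difference operator sends \<open>k \<mapsto> A\<^sup>k N\<^sup>j\<close> to \<open>k \<mapsto> A\<^sup>k N\<^sup>j\<^sup>+\<^sup>1\<close>, so nilpotence
  of \<open>N\<close> says that high differences of the entries of \<open>A\<^sup>k\<close> vanish.\<close>

lemma unipotent_power_entries_polynomial:
  assumes "unipotent_matrix A"
  shows "polynomial_in of_nat (\<lambda>k. matrix_power A k $ a $ b)"
proof -
  define N where "N j = (((**) (A - mat 1)) ^^ j) (mat 1)" for j
  obtain m where m: "N m = 0"
    using assms unfolding unipotent_matrix_def N_def by blast
  have N_Suc: "N (Suc j) = (A - mat 1) ** N j" for j
    by (simp add: N_def)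
  have vanish: "N j = 0" if "j \<ge> m" for j
    using that by (induction j rule: dec_induct) (simp_all add: m N_Suc)
  define f where "f j k = (matrix_power A k ** N j) $ a $ b" for j k
  have "f j (Suc k) = f j k + f (Suc j) k" for j k
  proof -
    have "A ** N j = N j + N (Suc j)"
      using matrix_add_rdistrib[of "mat 1" "A - mat 1" "N j"] by (simp add: N_Suc)
    then have "matrix_power A (Suc k) ** N j
        = matrix_power A k ** N j + matrix_power A k ** N (Suc j)"
      by (simp add: matrix_mul_assoc[symmetric] matrix_add_ldistrib)
    then show ?thesis
      by (simp add: f_def)
  qed
  moreover have "f j 0 = 0" if "j \<ge> m" for j
    using vanish[OF that] by (simp add: f_def)
  ultimately have "polynomial_in of_nat (f 0)"
    by (rule polynomial_in_if_differences_vanish)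
  then show ?thesis
    by (simp add: f_def[abs_def] N_def)
qed

lemma generated_algebra_sum:
  assumes "\<And>i. i \<in> I \<Longrightarrow> f i \<in> generated_algebra X"
  shows "(\<lambda>x. \<Sum>i\<in>I. f i x) \<in> generated_algebra X"
  using assms
  by (induction I rule: infinite_finite_induct)
    (auto intro: generated_algebra.const generated_algebra.add)

lemma generated_algebra_prod:
  assumes "\<And>i. i \<in> I \<Longrightarrow> f i \<in> generated_algebra X"
  shows "(\<lambda>x. \<Prod>i\<in>I. f i x) \<in> generated_algebra X"
  using assms
  by (induction I rule: infinite_finite_induct)
    (auto intro: generated_algebra.const generated_algebra.mult)

lemma det_in_generated_algebra:
  "det \<in> generated_algebra (matrix_entries :: (complex ^ 'n ^ 'n \<Rightarrow> complex) set)"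
proof -
  have "(\<lambda>A :: complex ^ 'n ^ 'n. \<Sum>p | p permutes UNIV.
      of_int (sign p) * (\<Prod>i\<in>UNIV. A $ i $ p i)) \<in> generated_algebra matrix_entries"
    by (intro generated_algebra_sum generated_algebra.mult generated_algebra.const
        generated_algebra_prod generated_algebra.gen) (auto simp: matrix_entries_def)
  then show ?thesis
    by (simp add: det_def[abs_def])
qed

lemma matrix_entries_power_polynomial:
  assumes "unipotent_matrix A" "x \<in> matrix_entries"
  shows "polynomial_in of_nat (\<lambda>k. x (matrix_power A k))"
  using assms by (auto simp: matrix_entries_def unipotent_power_entries_polynomial)

text \<open>Here \<open>det (A\<^sup>k)\<close> is at once polynomial and geometric in \<open>k\<close>.\<close>

lemma unipotent_det_eq_1:
  assumes "unipotent_matrix A"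
  shows "det A = 1"
proof (rule geometric_polynomial_ratio_eq_1)
  show "polynomial_in of_nat (\<lambda>k. det (matrix_power A k))"
    using det_in_generated_algebra matrix_entries_power_polynomial[OF assms]
    by (rule polynomial_in_generated_algebra)
  show "det (matrix_power A (Suc k)) = det A * det (matrix_power A k)" for k
    by (simp add: det_mul)
  show "det (matrix_power A 0) \<noteq> 0"
    by simp
qed

lemma regular_on_power_polynomial:
  assumes "unipotent_matrix A" "regular_on G f" "\<And>k. matrix_power A k \<in> G"
  shows "polynomial_in of_nat (\<lambda>k. f (matrix_power A k))"
proof -
  obtain p where p: "p \<in> generated_algebra (matrix_entries \<union> {\<lambda>A. inverse (det A)})"
    and fp: "\<forall>A\<in>G. f A = p A"
    using assms(2) unfolding regular_on_def by blast
  have det: "det (matrix_power A k) = 1" for k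
    by (induction k) (simp_all add: det_mul unipotent_det_eq_1[OF assms(1)])
  have "polynomial_in of_nat (\<lambda>k. p (matrix_power A k))"
    using p
  proof (rule polynomial_in_generated_algebra)
    fix x :: "complex ^ 'a ^ 'a \<Rightarrow> complex"
    assume "x \<in> matrix_entries \<union> {\<lambda>A. inverse (det A)}"
    then show "polynomial_in of_nat (\<lambda>k. x (matrix_power A k))"
      using matrix_entries_power_polynomial[OF assms(1)]
      by (auto simp: det polynomial_in_const)
  qed
  then show ?thesis
    using fp assms(3) by simp
qed

section \<open>Zariski-open sets and lines\<close>

lemma linear_functional_nonzero_at:
  assumes "vector_space scl" "v \<noteq> 0"
  obtains l where "l \<in> linear_functionals scl" "l v \<noteq> 0"
proof -
  interpret V: vector_space scl by fact
  interpret pair: vector_space_pair scl "(*) :: complex \<Rightarrow> complex \<Rightarrow> complex"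
    by unfold_locales
  have "\<not> V.dependent {v}"
    using assms(2) by simp
  then obtain l where "Vector_Spaces.linear scl (*) l" "\<forall>x\<in>{v}. l x = 1"
    using pair.linear_independent_extend[of "{v}" "\<lambda>_. 1"] by auto
  then show ?thesis
    by (intro that[of l]) (auto simp: linear_functionals_def)
qed

text \<open>A function witnessing that \<open>v \<in> U\<close> restricts to a nonzero one-variable polynomial on the
  line, whose finitely many zeros contain every parameter at which the line leaves \<open>U\<close>.\<close>

lemma zariski_open_meets_line:
  assumes "vector_space scl"
    and "openin (zariski_topology (linear_functionals scl)) U" "v \<in> U" "finite F"
  obtains t where "t \<notin> F" "v + scl t w \<in> U"
proof -
  interpret V: vector_space scl by fact
  obtain S where S: "S \<subseteq> generated_algebra (linear_functionals scl)"
    and U: "U = - {x. \<forall>f\<in>S. f x = 0}"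
    using assms(2) unfolding openin_zariski by blast
  obtain f where f: "f \<in> S" "f v \<noteq> 0"
    using assms(3) U by blast
  have "polynomial_in (\<lambda>t. t) (\<lambda>t. f (v + scl t w))"
    using subsetD[OF S f(1)]
  proof (rule polynomial_in_generated_algebra)
    fix l assume "l \<in> linear_functionals scl"
    then interpret l: Vector_Spaces.linear scl "(*)" l
      by (simp add: linear_functionals_def)
    show "polynomial_in (\<lambda>t. t) (\<lambda>t. l (v + scl t w))"
      unfolding l.add l.scale
      by (intro polynomial_in_add polynomial_in_mult polynomial_in_const polynomial_in_self)
  qed
  then obtain q where q: "f (v + scl t w) = poly q t" for t
    unfolding polynomial_in_def by blast
  have "q \<noteq> 0"
    using q[of 0] f(2) by auto
  then have "finite ({t. poly q t = 0} \<union> F)"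
    using poly_roots_finite[of q] assms(4) by simp
  then obtain t where "t \<notin> {t. poly q t = 0} \<union> F"
    using ex_new_if_finite[OF infinite_UNIV_char_0] by metis
  then have "t \<notin> F" "f (v + scl t w) \<noteq> 0"
    by (simp_all add: q)
  with f(1) show ?thesis
    by (intro that[of t]) (auto simp: U)
qed

section \<open>Representations of unipotent groups\<close>

lemma matrix_power_in_subgroup:
  assumes "subgroup G GL_mat" "A \<in> G"
  shows "matrix_power A k \<in> G"
proof (induction k)
  case 0
  show ?case
    using subgroup.one_closed[OF assms(1)] by (simp add: GL_mat_def)
next
  case (Suc k)
  then show ?case
    using subgroup.m_closed[OF assms(1) Suc assms(2)] by (simp add: GL_mat_def)
qed

lemma rational_representation_linear:
  assumes "rational_representation G scl \<rho>" "A \<in> G"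
  shows "Vector_Spaces.linear scl scl (\<rho> A)" "bij (\<rho> A)"
  using assms by (auto simp: rational_representation_def GL_space_def hom_def Pi_iff)

lemma rational_representation_mult:
  assumes "rational_representation G scl \<rho>" "A \<in> G" "B \<in> G"
  shows "\<rho> (A ** B) x = \<rho> A (\<rho> B x)"
  using assms
  by (auto simp: rational_representation_def GL_space_def GL_mat_def hom_def Pi_iff)

lemma rational_representation_one:
  assumes "rational_representation G scl \<rho>" "mat 1 \<in> G"
  shows "\<rho> (mat 1) x = x"
proof -
  have "\<rho> (mat 1) (\<rho> (mat 1) x) = \<rho> (mat 1) x"
    using rational_representation_mult[OF assms(1) assms(2) assms(2)] by simp
  then show ?thesis
    using rational_representation_linear(2)[OF assms] by (simp add: bij_def inj_eq)
qed

text \<open>The sequence \<open>l (\<rho>(A\<^sup>k) v)\<close> is polynomial in \<open>k\<close> by rationality and geometric with ratio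
  \<open>c\<close> by the eigenvalue equation.\<close>

lemma unipotent_eigenvalue_eq_1:
  assumes rep: "rational_representation G scl \<rho>"
    and G: "subgroup G GL_mat"
    and A: "A \<in> G" "unipotent_matrix A"
    and v: "\<rho> A v = scl c v" "v \<noteq> 0"
  shows "c = 1"
proof -
  interpret A: Vector_Spaces.linear scl scl "\<rho> A"
    using rational_representation_linear(1)[OF rep A(1)] .
  obtain l where l: "l \<in> linear_functionals scl" "l v \<noteq> 0"
    using linear_functional_nonzero_at[OF A.vs1.vector_space_axioms v(2)] .
  interpret l: Vector_Spaces.linear scl "(*)" l
    using l(1) by (simp add: linear_functionals_def)
  have powers: "matrix_power A k \<in> G" for k
    using matrix_power_in_subgroup[OF G A(1)] .
  show ?thesis
  proof (rule geometric_polynomial_ratio_eq_1)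
    have "regular_on G (\<lambda>B. l (\<rho> B v))"
      using rep l(1) by (simp add: rational_representation_def)
    then show "polynomial_in of_nat (\<lambda>k. l (\<rho> (matrix_power A k) v))"
      by (rule regular_on_power_polynomial[OF A(2) _ powers])
    show "l (\<rho> (matrix_power A (Suc k)) v) = c * l (\<rho> (matrix_power A k) v)" for k
    proof -
      interpret B: Vector_Spaces.linear scl scl "\<rho> (matrix_power A k)"
        using rational_representation_linear(1)[OF rep powers] .
      show ?thesis
        by (simp add: rational_representation_mult[OF rep powers A(1)] v(1) B.scale l.scale)
    qed
    have "mat 1 \<in> G"
      using powers[of 0] by simp
    then show "l (\<rho> (matrix_power A 0) v) \<noteq> 0"
      using l(2) rational_representation_one[OF rep] by simp
  qed
qed

theorem corollary4p6:
  fixes G :: "(complex ^ 'n ^ 'n) set"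
    and scl :: "complex \<Rightarrow> 'v::ab_group_add \<Rightarrow> 'v"
    and Basis :: "'v set"
  assumes "unipotent_group G"
    and "group_dim G > 0"
    and "finite_dimensional_vector_space scl Basis"
  shows "\<not> (\<exists>\<rho>. etale_representation G scl \<rho>)"
proof
  interpret V: finite_dimensional_vector_space scl Basis by fact
  assume "\<exists>\<rho>. etale_representation G scl \<rho>"
  then obtain \<rho> v where rep: "rational_representation G scl \<rho>"
    and orbit: "openin (zariski_topology (linear_functionals scl)) ((\<lambda>A. \<rho> A v) ` G)"
    and dim: "group_dim G = enat (V.dim (UNIV :: 'v set))"
    unfolding etale_representation_def by blast
  have G: "subgroup G GL_mat" and unipotent: "\<And>A. A \<in> G \<Longrightarrow> unipotent_matrix A"
    using assms(1) by (auto simp: unipotent_group_def linear_algebraic_group_def)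
  have one: "mat 1 \<in> G"
    using subgroup.one_closed[OF G] by (simp add: GL_mat_def)
  have v_in_orbit: "v \<in> (\<lambda>A. \<rho> A v) ` G"
    using one by (rule rev_image_eqI) (simp add: rational_representation_one[OF rep one])
  note line = zariski_open_meets_line[OF V.vector_space_axioms orbit v_in_orbit]
  (* For v = 0 the line must point in another direction, which exists because dim V > 0. *)
  show False
  proof (cases "v = 0")
    case True
    have "V.dim (UNIV :: 'v set) \<noteq> 0"
      using assms(2) dim by (simp add: zero_enat_def)
    then obtain w :: 'v where "w \<noteq> 0"
      by (metis V.dim_eq_0 insertI1 subsetI singleton_iff)
    obtain t where t: "t \<notin> {0}" "v + scl t w \<in> (\<lambda>A. \<rho> A v) ` G"
      using line[of "{0}" w] by blast
    then obtain A where A: "A \<in> G" "v + scl t w = \<rho> A v"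
      by blast
    interpret A: Vector_Spaces.linear scl scl "\<rho> A"
      using rational_representation_linear(1)[OF rep A(1)] .
    have "scl t w = 0"
      using A(2) True A.zero by simp
    then show False
      using t(1) \<open>w \<noteq> 0\<close> by simp
  next
    case False
    obtain t where t: "t \<notin> {0}" "v + scl t v \<in> (\<lambda>A. \<rho> A v) ` G"
      using line[of "{0}" v] by blast
    then obtain A where A: "A \<in> G" "\<rho> A v = v + scl t v"
      by (metis imageE)
    have "\<rho> A v = scl (1 + t) v"
      using A(2) by (simp add: V.scale_left_distrib)
    then have "1 + t = 1"
      using unipotent_eigenvalue_eq_1[OF rep G A(1) unipotent[OF A(1)]] False by blast
    then show False
      using t(1) by simp
  qed
qed

end
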